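(* The word $w_o$ is boundedly concise in the class of residually finite groups. That is, for every positive integer $m$ there is a number $f$, depending only on $m$ and the word $w_o$, such that whenever $G$ is a residually finite group in which $w_o$ takes at most $m$ values, the verbal subgroup $w_o(G)$ is finite of order at most $f$.
   Context: For a group-word $w=w(x,y)$ and a group $G$, a $w$-value in $G$ is an element of the form $w(a,b)$ with $a,b\in G$, and the verbal subgroup $w(G)$ is the subgroup of $G$ generated by all $w$-values. A word $w$ is boundedly concise in a class of groups $\mathcal C$ if $w(G)$ is finite of $(m,w)$-bounded order (i.e. of order bounded in terms of $m$ and $w$ only) whenever $w$ takes at most $m$ values in a group $G\in\mathcal C$. The word $w_o$ (Olshanskii's word): for positive integers $d$ and $n$ set $$v(x,y)=[[x^d,y^d]^d,[y^d,x^{-d}]^d]$$ and $$w_o(x,y)=[x,y]\,v(x,y)^n[x,y]^{\varepsilon_1}v(x,y)^{n+1}\cdots [x,y]^{\varepsilon_{h-1}}v(x,y)^{n+h-1},$$ where $h\equiv 1 \pmod{10}$, $h>50000$, and $$\varepsilon_{10k+1}=\varepsilon_{10k+2}=\varepsilon_{10k+3}=\varepsilon_{10k+5}=\varepsilon_{10k+6}=1,$$ $$\varepsilon_{10k+4}=\varepsilon_{10k+7}=\varepsilon_{10k+8}=\varepsilon_{10k+9}=\varepsilon_{10k+10}=-1$$ for $k=0,1,2,\ldots$ (only $\varepsilon_1,\ldots,\varepsilon_{h-1}$ occur in the word). The parameters are fixed, as chosen by Olshanskii, so that the variety of groups in which $w_o$ is a law contains infinite non-abelian groups, all finite groups in this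 variety are abelian, and $w_o$ is not concise in the class of all groups (i.e. there is a group $H$ in which $w_o$ takes only finitely many values but $w_o(H)$ is infinite). *)

theory Defs
  imports "HOL-Algebra.Algebra"
begin

text \<open>
  Group-words in \<open>x, y\<close> are represented by formal terms. Terms that are equal in the free group
  take the same values in every group, so nothing below depends on the choice of term.
\<close>

datatype gword = VarX | VarY | One | Mult gword gword | Inv gword

fun word_eval :: "('a, 'c) monoid_scheme \<Rightarrow> gword \<Rightarrow> 'a \<Rightarrow> 'a \<Rightarrow> 'a" where
  "word_eval G VarX a b = a"
| "word_eval G VarY a b = b"
| "word_eval G One a b = \<one>\<^bsub>G\<^esub>"
| "word_eval G (Mult u v) a b = word_eval G u a b \<otimes>\<^bsub>G\<^esub> word_eval G v a b"
| "word_eval G (Inv u) a b = inv\<^bsub>G\<^esub> (word_eval G u a b)"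

definition word_values :: "('a, 'c) monoid_scheme \<Rightarrow> gword \<Rightarrow> 'a set" where
  "word_values G w = {word_eval G w a b | a b. a \<in> carrier G \<and> b \<in> carrier G}"

definition verbal_subgroup :: "('a, 'c) monoid_scheme \<Rightarrow> gword \<Rightarrow> 'a set" where
  "verbal_subgroup G w = generate G (word_values G w)"

definition is_law :: "('a, 'c) monoid_scheme \<Rightarrow> gword \<Rightarrow> bool" where
  "is_law G w \<longleftrightarrow> (\<forall>a\<in>carrier G. \<forall>b\<in>carrier G. word_eval G w a b = \<one>\<^bsub>G\<^esub>)"

definition residually_finite :: "('a, 'c) monoid_scheme \<Rightarrow> bool" where
  "residually_finite G \<longleftrightarrow>
     (\<forall>g\<in>carrier G. g \<noteq> \<one>\<^bsub>G\<^esub> \<longrightarrow> (\<exists>N. N \<lhd> G \<and> finite (rcosets\<^bsub>G\<^esub> N) \<and> g \<notin> N))"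

text \<open>
  Bounded conciseness of \<open>w\<close> in the class \<open>C\<close> means that for every \<open>m\<close> some \<open>f\<close>, the same for
  all groups in \<open>C\<close>, satisfies \<open>verbal_order_bound C w m f\<close>. Here \<open>C\<close> is a class of groups whose
  elements have the fixed type \<open>'a\<close>.
\<close>

definition verbal_order_bound :: "('a monoid \<Rightarrow> bool) \<Rightarrow> gword \<Rightarrow> nat \<Rightarrow> nat \<Rightarrow> bool" where
  "verbal_order_bound C w m f \<longleftrightarrow>
     (\<forall>G. group G \<longrightarrow> C G \<longrightarrow> finite (word_values G w) \<longrightarrow> card (word_values G w) \<le> m \<longrightarrow>
        finite (verbal_subgroup G w) \<and> card (verbal_subgroup G w) \<le> f)"

fun wpow :: "gword \<Rightarrow> nat \<Rightarrow> gword" where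
  "wpow u 0 = One"
| "wpow u (Suc k) = Mult (wpow u k) u"

definition wpow_int :: "gword \<Rightarrow> int \<Rightarrow> gword" where
  "wpow_int u k = (if k < 0 then Inv (wpow u (nat (- k))) else wpow u (nat k))"

text \<open>The convention is \<open>[u, v] = u\<^sup>-\<^sup>1 v\<^sup>-\<^sup>1 u v\<close>.\<close>

definition wcomm :: "gword \<Rightarrow> gword \<Rightarrow> gword" where
  "wcomm u v = Mult (Mult (Inv u) (Inv v)) (Mult u v)"

definition olsh_v :: "nat \<Rightarrow> gword" where
  "olsh_v d =
     wcomm (wpow (wcomm (wpow VarX d) (wpow VarY d)) d)
           (wpow (wcomm (wpow VarY d) (wpow_int VarX (- int d))) d)"

definition olsh_eps :: "nat \<Rightarrow> int" where
  "olsh_eps i = (if i mod 10 \<in> {1, 2, 3, 5, 6} then 1 else - 1)"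

text \<open>
  The leading factor \<open>[x, y] v\<^sup>n\<close> has exponent \<open>1\<close>, not \<open>olsh_eps 0\<close>, so it is kept outside
  the list; the \<open>i\<close>-th further factor is \<open>[x, y]\<close> to the power \<open>olsh_eps i\<close> times \<open>v\<close> to the
  power \<open>n + i\<close>, for \<open>i = 1, \<dots>, h - 1\<close> in this order.
\<close>

definition olsh_word :: "nat \<Rightarrow> nat \<Rightarrow> nat \<Rightarrow> gword" where
  "olsh_word d n h =
     foldl Mult (Mult (wcomm VarX VarY) (wpow (olsh_v d) n))
       (map (\<lambda>i. Mult (wpow_int (wcomm VarX VarY) (olsh_eps i)) (wpow (olsh_v d) (n + i))) [1..<h])"

text \<open>
  HOL cannot quantify over all types inside a formula, so a bound obtained separately for each
  element type could vary with the type. A bound is independent of the type if it is chosen for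
  groups with elements in \<^typ>\<open>nat\<close> (up to isomorphism, all countable groups) and every bound
  chosen in this way is also valid for groups with elements in an arbitrary type \<open>'a\<close>.
\<close>

definition boundedly_concise_rf :: "'a itself \<Rightarrow> gword \<Rightarrow> bool" where
  "boundedly_concise_rf T w \<longleftrightarrow>
     (\<forall>m>0.
        (\<exists>f. verbal_order_bound (residually_finite :: nat monoid \<Rightarrow> bool) w m f) \<and>
        (\<forall>f. verbal_order_bound (residually_finite :: nat monoid \<Rightarrow> bool) w m f \<longrightarrow>
             verbal_order_bound (residually_finite :: 'a monoid \<Rightarrow> bool) w m f))"

end

theory Submission
  imports Defs
begin

text \<open>
  Write \<open>w\<close> for Olshanskii's word, \<open>S\<close> for the set of its values in a residually finite group
  \<open>G\<close>, with at most \<open>m\<close> elements, and \<open>C\<close> for the centralizer of \<open>S\<close>. Since \<open>w\<close> is a product of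
  commutators, \<open>w(G)\<close> lies in the derived subgroup \<open>G'\<close>, and the proof bounds the order of all
  of \<open>G'\<close> in terms of \<open>m\<close>.

  Residual finiteness contributes to this bound the fact that \<open>C\<close> centralizes \<open>G'\<close>
  (\<open>centralizer_of_word_values_centralizes_commutators\<close>). In a finite quotient \<open>Q\<close> the group
  \<open>Q/w(Q)\<close> is finite and satisfies the law \<open>w\<close>, so it is abelian and \<open>Q' \<le> w(Q)\<close>; the image of
  \<open>C\<close> centralizes \<open>w(Q)\<close>, which is the image of \<open>w(G)\<close>. Hence \<open>[C, G']\<close> is trivial in every finite
  quotient, and so it is trivial.

  Now take \<open>c \<in> C\<close> and \<open>g \<in> G\<close>. The two factors of the commutator \<open>v(c, g)\<close> are powers of
  commutators, and the first one lies in \<open>C\<close>, so \<open>v(c, g) = 1\<close>. The signs \<open>\<epsilon>\<^sub>i\<close> cancel in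
  blocks of ten, so what remains of \<open>w(c, g)\<close> is \<open>[c, g]\<close>: every such commutator is a value of
  \<open>w\<close> (\<open>olsh_word_value_commutator\<close>).

  This is enough to bound \<open>G'\<close> (\<open>finite_derived_subgroup_of_centralizing_commutators\<close>).
  For fixed \<open>g\<close> the map \<open>c \<mapsto> [c, g]\<close> is a homomorphism with at most \<open>m\<close> values, so \<open>c\<close> raised to
  the power \<open>m!\<close> is central. The group \<open>G\<close> acts on \<open>S\<close> by conjugation with kernel \<open>C\<close>, in at most
  \<open>m\<^sup>m\<close> ways; hence a fixed power of every commutator is central, and comparing \<open>x\<close> and \<open>y\<close> with
  representatives of their cosets modulo \<open>C\<close> leaves boundedly many values for \<open>[x, y]\<close>. A group
  with \<open>n\<close> commutators, each with central \<open>k\<close>-th power, has a derived subgroup of order at most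
  \<open>n\<^bsup>n k\<^esup>\<close> by the collection argument behind Schur's theorem (\<open>finite_derived_subgroup\<close>).

  Finally, any bound that is valid for groups on the natural numbers is valid for groups on an
  arbitrary type (\<open>verbal_order_bound_transfer\<close>): if \<open>w\<close> takes finitely many values in \<open>G\<close>, then
  the arguments that produce them generate a countable subgroup with the same values of \<open>w\<close> and
  therefore with the same verbal subgroup.
\<close>

section \<open>Commutators and centralizers\<close>

text \<open>
  The convention \<open>[x, y] = x\<^sup>-\<^sup>1 y\<^sup>-\<^sup>1 x y\<close> is that of \<^const>\<open>wcomm\<close>. It gives the same set of commutators
  as the convention \<open>x y x\<^sup>-\<^sup>1 y\<^sup>-\<^sup>1\<close> behind \<^const>\<open>derived\<close>, but not the same value for given \<open>x\<close> and \<open>y\<close>.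
\<close>

definition commutator :: "('a, 'c) monoid_scheme \<Rightarrow> 'a \<Rightarrow> 'a \<Rightarrow> 'a" where
  "commutator G x y = inv\<^bsub>G\<^esub> x \<otimes>\<^bsub>G\<^esub> inv\<^bsub>G\<^esub> y \<otimes>\<^bsub>G\<^esub> (x \<otimes>\<^bsub>G\<^esub> y)"

definition commutators :: "('a, 'c) monoid_scheme \<Rightarrow> 'a set" where
  "commutators G = {commutator G x y | x y. x \<in> carrier G \<and> y \<in> carrier G}"

context group
begin

lemma inv_mult_cancel:
  assumes "x \<in> carrier G" "y \<in> carrier G"
  shows "inv x \<otimes> (x \<otimes> y) = y" "x \<otimes> (inv x \<otimes> y) = y"
  using assms by (simp_all flip: m_assoc)

text \<open>
  These rewrite rules reduce a product of elements and their inverses to a right-nested, freely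
  reduced form, so the simplifier proves with them every identity that holds in all groups.
\<close>

lemmas free_group_simps = m_assoc inv_mult_group inv_mult_cancel

lemma commutator_closed [simp, intro]:
  "x \<in> carrier G \<Longrightarrow> y \<in> carrier G \<Longrightarrow> commutator G x y \<in> carrier G"
  by (simp add: commutator_def)

lemma commutators_subset: "commutators G \<subseteq> carrier G"
  by (auto simp: commutators_def)

lemma commutator_in_commutators [intro]:
  "x \<in> carrier G \<Longrightarrow> y \<in> carrier G \<Longrightarrow> commutator G x y \<in> commutators G"
  unfolding commutators_def by blast

lemma inv_commutator:
  assumes "x \<in> carrier G" "y \<in> carrier G"
  shows "inv (commutator G x y) = commutator G y x"
  using assms by (simp add: commutator_def free_group_simps)

lemma commutator_eq_one_iff:
  assumes "x \<in> carrier G" "y \<in> carrier G"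
  shows "commutator G x y = \<one> \<longleftrightarrow> x \<otimes> y = y \<otimes> x"
proof -
  have "commutator G x y = inv (y \<otimes> x) \<otimes> (x \<otimes> y)"
    using assms by (simp add: commutator_def inv_mult_group)
  then show ?thesis
    using assms by (metis inv_solve_left m_closed one_closed r_one inv_closed)
qed

text \<open>
  In general \<open>[x y, z] = [x, z]\<^sup>y [y, z]\<close>; when \<open>y\<close> commutes with \<open>[x, z]\<close> the conjugation
  disappears.
\<close>

lemma commutator_mult_left:
  assumes "x \<in> carrier G" "y \<in> carrier G" "z \<in> carrier G"
    and "y \<otimes> commutator G x z = commutator G x z \<otimes> y"
  shows "commutator G (x \<otimes> y) z = commutator G x z \<otimes> commutator G y z"
proof -
  have "commutator G (x \<otimes> y) z = inv y \<otimes> (commutator G x z \<otimes> y) \<otimes> commutator G y z"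
    using assms(1-3) by (simp add: commutator_def free_group_simps)
  also have "\<dots> = commutator G x z \<otimes> commutator G y z"
    unfolding assms(4)[symmetric] using assms(1-3) by (simp add: inv_mult_cancel)
  finally show ?thesis .
qed

lemma commutator_mult_right:
  assumes "x \<in> carrier G" "y \<in> carrier G" "z \<in> carrier G"
    and "z \<otimes> commutator G x y = commutator G x y \<otimes> z"
  shows "commutator G x (y \<otimes> z) = commutator G x z \<otimes> commutator G x y"
proof -
  have "commutator G x (y \<otimes> z) = commutator G x z \<otimes> (inv z \<otimes> (commutator G x y \<otimes> z))"
    using assms(1-3) by (simp add: commutator_def free_group_simps)
  also have "\<dots> = commutator G x z \<otimes> commutator G x y"
    unfolding assms(4)[symmetric] using assms(1-3) by (simp add: inv_mult_cancel)
  finally show ?thesis .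
qed

lemma conj_hom: "g \<in> carrier G \<Longrightarrow> (\<lambda>x. g \<otimes> x \<otimes> inv g) \<in> hom G G"
  by (auto intro!: homI simp: free_group_simps)

lemma pow_commute:
  assumes "x \<in> carrier G" "y \<in> carrier G" "x \<otimes> y = y \<otimes> x"
  shows "x [^] (n::nat) \<otimes> y = y \<otimes> x [^] n"
proof (induction n)
  case (Suc n)
  have "x [^] Suc n \<otimes> y = x [^] n \<otimes> (x \<otimes> y)" using assms by (simp add: m_assoc)
  also have "\<dots> = (x [^] n \<otimes> y) \<otimes> x" using assms by (simp add: m_assoc)
  also have "\<dots> = y \<otimes> x [^] Suc n" unfolding Suc.IH using assms by (simp add: m_assoc)
  finally show ?case .
qed (use assms in simp)

lemma conj_nat_pow:
  assumes "g \<in> carrier G" "x \<in> carrier G"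
  shows "g \<otimes> x [^] (n::nat) \<otimes> inv g = (g \<otimes> x \<otimes> inv g) [^] n"
  using hom_nat_pow[OF conj_hom[OF assms(1)] assms(2) is_group is_group] by simp

lemma subgroup_nat_pow_closed:
  assumes "subgroup D G" "x \<in> D" shows "x [^] (n::nat) \<in> D"
  using subgroup_int_pow_closed[OF assms, of "int n"] by (simp add: int_pow_int)

end

definition centralizer :: "('a, 'c) monoid_scheme \<Rightarrow> 'a set \<Rightarrow> 'a set" where
  "centralizer G S = {c \<in> carrier G. \<forall>s\<in>S. c \<otimes>\<^bsub>G\<^esub> s = s \<otimes>\<^bsub>G\<^esub> c}"

context group
begin

lemma inv_commute:
  assumes "x \<in> carrier G" "y \<in> carrier G" "x \<otimes> y = y \<otimes> x"
  shows "inv x \<otimes> y = y \<otimes> inv x"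
proof -
  have "inv x \<otimes> y = inv x \<otimes> (y \<otimes> x) \<otimes> inv x" using assms(1,2) by (simp add: m_assoc)
  also have "\<dots> = y \<otimes> inv x" unfolding assms(3)[symmetric] using assms(1,2) by (simp add: inv_mult_cancel)
  finally show ?thesis .
qed

lemma subgroup_centralizer:
  assumes "S \<subseteq> carrier G" shows "subgroup (centralizer G S) G"
proof
  fix x y assume xy: "x \<in> centralizer G S" "y \<in> centralizer G S"
  have "x \<otimes> y \<otimes> s = s \<otimes> (x \<otimes> y)" if s: "s \<in> S" for s
  proof -
    have c: "x \<in> carrier G" "y \<in> carrier G" "s \<in> carrier G" "x \<otimes> s = s \<otimes> x" "y \<otimes> s = s \<otimes> y"
      using xy s assms by (auto simp: centralizer_def)
    have "x \<otimes> y \<otimes> s = x \<otimes> s \<otimes> y" using c(1-3,5) by (simp add: m_assoc)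
    also have "\<dots> = s \<otimes> (x \<otimes> y)" unfolding c(4) using c(1-3) by (simp add: m_assoc)
    finally show ?thesis .
  qed
  then show "x \<otimes> y \<in> centralizer G S" using xy by (simp add: centralizer_def)
  show "inv x \<in> centralizer G S"
    using xy(1) assms by (auto simp: centralizer_def intro: inv_commute)
qed (use assms in \<open>auto simp: centralizer_def\<close>)

lemma centralizer_conj:
  assumes "S \<subseteq> carrier G" and conj: "\<And>g s. g \<in> carrier G \<Longrightarrow> s \<in> S \<Longrightarrow> g \<otimes> s \<otimes> inv g \<in> S"
    and c: "c \<in> centralizer G S" and g: "g \<in> carrier G"
  shows "g \<otimes> c \<otimes> inv g \<in> centralizer G S"
proof -
  have cc: "c \<in> carrier G" using c by (simp add: centralizer_def)
  have "g \<otimes> c \<otimes> inv g \<otimes> s = s \<otimes> (g \<otimes> c \<otimes> inv g)" if s: "s \<in> S" for s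
  proof -
    let ?s = "inv g \<otimes> s \<otimes> g"
    have sc: "s \<in> carrier G" using s assms(1) by blast
    have "?s \<in> S" using conj[of "inv g" s] g s by simp
    then have eq: "c \<otimes> ?s = ?s \<otimes> c" using c by (simp add: centralizer_def)
    have "g \<otimes> c \<otimes> inv g \<otimes> s = g \<otimes> (c \<otimes> ?s) \<otimes> inv g"
      using g cc sc by (simp add: free_group_simps)
    also have "\<dots> = s \<otimes> (g \<otimes> c \<otimes> inv g)"
      unfolding eq using g cc sc by (simp add: free_group_simps)
    finally show ?thesis .
  qed
  then show ?thesis using g cc by (simp add: centralizer_def)
qed

end

section \<open>Groups with finitely many commutators\<close>

context group
begin

definition list_product :: "'a list \<Rightarrow> 'a" where
  "list_product xs = foldr (\<otimes>) xs \<one>"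

lemma list_product_simps [simp]:
  "list_product [] = \<one>" "list_product (x # xs) = x \<otimes> list_product xs"
  by (simp_all add: list_product_def)

lemma list_product_closed [simp]: "set xs \<subseteq> carrier G \<Longrightarrow> list_product xs \<in> carrier G"
  by (induction xs) auto

lemma list_product_append:
  "set xs \<subseteq> carrier G \<Longrightarrow> set ys \<subseteq> carrier G \<Longrightarrow>
     list_product (xs @ ys) = list_product xs \<otimes> list_product ys"
  by (induction xs) (auto simp: m_assoc)

lemma list_product_replicate:
  "x \<in> carrier G \<Longrightarrow> list_product (replicate n x) = x [^] n"
  by (induction n) (simp_all flip: nat_pow_Suc2)

lemma generate_subset_list_products:
  assumes "T \<subseteq> carrier G" "\<And>t. t \<in> T \<Longrightarrow> inv t \<in> T"
  shows "generate G T \<subseteq> list_product ` lists T"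
proof
  fix g assume "g \<in> generate G T"
  then show "g \<in> list_product ` lists T"
  proof (induction rule: generate.induct)
    case one
    then show ?case by (intro image_eqI[of _ _ "[]"]) auto
  next
    case (incl h)
    then show ?case using assms by (intro image_eqI[of _ _ "[h]"]) auto
  next
    case (inv h)
    then show ?case using assms by (intro image_eqI[of _ _ "[inv h]"]) auto
  next
    case (eng h1 h2)
    then obtain xs ys where "xs \<in> lists T" "ys \<in> lists T" "h1 = list_product xs" "h2 = list_product ys"
      by blast
    then show ?case using assms(1)
      by (intro image_eqI[of _ _ "xs @ ys"]) (auto simp: list_product_append in_lists_conv_set subset_iff)
  qed
qed

text \<open>
  Moving every occurrence of \<open>s\<close> in a product to the front replaces the factors it passes by
  conjugates, so the number of factors stays the same.
\<close>

lemma collect_factor: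
  assumes "T \<subseteq> carrier G" "\<And>x y. x \<in> T \<Longrightarrow> y \<in> T \<Longrightarrow> inv y \<otimes> x \<otimes> y \<in> T"
    and "s \<in> T" "set xs \<subseteq> T"
  shows "\<exists>ys. set ys \<subseteq> T \<and> length ys + count_list xs s = length xs \<and>
           list_product xs = s [^] count_list xs s \<otimes> list_product ys"
  using assms(4)
proof (induction xs)
  case (Cons x xs)
  then obtain ys where ys: "set ys \<subseteq> T" "length ys + count_list xs s = length xs"
      "list_product xs = s [^] count_list xs s \<otimes> list_product ys"
    by auto
  have cl: "s \<in> carrier G" "x \<in> carrier G" "list_product ys \<in> carrier G"
    using assms Cons.prems ys by auto
  show ?case
  proof (cases "x = s")
    case True
    then show ?thesis using ys cl
      by (intro exI[of _ ys]) (auto simp flip: m_assoc nat_pow_Suc2)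
  next
    case False
    define p where "p = s [^] count_list xs s"
    have conj_pow: "inv (s [^] j) \<otimes> x \<otimes> s [^] j \<in> T" for j :: nat
    proof (induction j)
      case (Suc j)
      show ?case using assms(2)[OF Suc.IH \<open>s \<in> T\<close>] cl by (simp add: free_group_simps)
    qed (use cl Cons.prems in simp)
    have "x \<otimes> (p \<otimes> list_product ys) = p \<otimes> (inv p \<otimes> x \<otimes> p \<otimes> list_product ys)"
      using cl by (simp add: p_def free_group_simps)
    then show ?thesis using False ys conj_pow[of "count_list xs s"] unfolding p_def
      by (intro exI[of _ "(inv (s [^] count_list xs s) \<otimes> x \<otimes> s [^] count_list xs s) # ys"]) auto
  qed
qed (auto intro!: exI[of _ "[]"])

lemma commutators_conj:
  assumes "t \<in> commutators G" "g \<in> carrier G"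
  shows "inv g \<otimes> t \<otimes> g \<in> commutators G"
proof -
  obtain x y where "t = commutator G x y" "x \<in> carrier G" "y \<in> carrier G"
    using assms by (auto simp: commutators_def)
  then have "inv g \<otimes> t \<otimes> g = commutator G (inv g \<otimes> x \<otimes> g) (inv g \<otimes> y \<otimes> g)"
    using assms(2) by (simp add: commutator_def free_group_simps)
  then show ?thesis using assms(2) \<open>x \<in> _\<close> \<open>y \<in> _\<close> unfolding commutators_def by blast
qed

text \<open>
  Rosenlicht's step in the proof of Schur's theorem. If \<open>t = [a, b]\<close> and \<open>t\<^sup>k\<close> is central, then
  \<open>t\<^bsup>k+1\<^esup> = t b\<^sup>-\<^sup>1 t\<^sup>k b = (t b\<^sup>-\<^sup>1 t b) (b\<^sup>-\<^sup>1 t b)\<^bsup>k-1\<^esup>\<close>, and \<open>t b\<^sup>-\<^sup>1 t b = [a, b\<^sup>2]\<close> is a single commutator. So \<open>k + 1\<close>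
  factors become \<open>k\<close>.
\<close>

lemma shorten_commutator_power:
  assumes "t \<in> commutators G" "k > 0" "\<And>x. x \<in> carrier G \<Longrightarrow> t [^] k \<otimes> x = x \<otimes> t [^] k"
  shows "\<exists>zs. set zs \<subseteq> commutators G \<and> length zs = k \<and> list_product zs = t [^] Suc k"
proof -
  obtain a b where t: "t = commutator G a b" and ab: "a \<in> carrier G" "b \<in> carrier G"
    using assms by (auto simp: commutators_def)
  have tc: "t \<in> carrier G" using t ab by simp
  obtain j where k: "k = Suc j" using assms(2) gr0_implies_Suc by blast
  let ?u = "inv b \<otimes> t \<otimes> b"
  have "t [^] Suc k = t \<otimes> t [^] k" using tc by (rule nat_pow_Suc2)
  also have "t [^] k = inv b \<otimes> (t [^] k \<otimes> b)"
    unfolding assms(3)[OF ab(2)] using ab tc by (simp add: inv_mult_cancel)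
  also have "t [^] k = t \<otimes> t [^] j" unfolding k using tc by (rule nat_pow_Suc2)
  also have "t \<otimes> (inv b \<otimes> (t \<otimes> t [^] j \<otimes> b)) = (t \<otimes> (inv b \<otimes> (t \<otimes> b))) \<otimes> (inv b \<otimes> t [^] j \<otimes> b)"
    using tc ab by (simp add: free_group_simps)
  also have "t \<otimes> (inv b \<otimes> (t \<otimes> b)) = commutator G a (b \<otimes> b)"
    using ab by (simp add: t commutator_def free_group_simps)
  also have "inv b \<otimes> t [^] j \<otimes> b = ?u [^] j"
    using conj_nat_pow[of "inv b" t j] ab tc by simp
  finally have "t [^] Suc k = list_product (commutator G a (b \<otimes> b) # replicate j ?u)"
    using ab tc by (simp add: list_product_replicate)
  moreover have "?u \<in> commutators G" using commutators_conj assms(1) ab by blast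
  moreover have "commutator G a (b \<otimes> b) \<in> commutators G" using ab by (auto simp: commutators_def)
  ultimately show ?thesis using k
    by (intro exI[of _ "commutator G a (b \<otimes> b) # replicate j ?u"]) auto
qed

text \<open>
  A product of more than \<open>n k\<close> out of \<open>n\<close> commutators repeats one of them more than \<open>k\<close> times;
  collecting \<open>k + 1\<close> of these occurrences allows the previous step.
\<close>

lemma shorten_commutator_product:
  assumes fin: "finite (commutators G)" and "k > 0"
    and central: "\<And>t x. t \<in> commutators G \<Longrightarrow> x \<in> carrier G \<Longrightarrow> t [^] k \<otimes> x = x \<otimes> t [^] k"
    and xs: "set xs \<subseteq> commutators G" "length xs > card (commutators G) * k"
  shows "\<exists>ys. set ys \<subseteq> commutators G \<and> length ys < length xs \<and> list_product ys = list_product xs"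
proof -
  let ?T = "commutators G"
  have "\<exists>s\<in>?T. count_list xs s > k"
  proof (rule ccontr)
    assume "\<not> ?thesis"
    then have "(\<Sum>s\<in>?T. count_list xs s) \<le> card ?T * k"
      using sum_bounded_above[of ?T "count_list xs" k] by (auto simp: not_less)
    then show False using sum_count_set[OF xs(1) fin] xs(2) by simp
  qed
  then obtain s where s: "s \<in> ?T" "count_list xs s > k" by blast
  obtain ys where ys: "set ys \<subseteq> ?T" "length ys + count_list xs s = length xs"
      "list_product xs = s [^] count_list xs s \<otimes> list_product ys"
    using collect_factor[OF commutators_subset _ s(1) xs(1)] commutators_conj commutators_subset
    by (metis subsetD)
  obtain zs where zs: "set zs \<subseteq> ?T" "length zs = k" "list_product zs = s [^] Suc k"
    using shorten_commutator_power[OF s(1) \<open>k > 0\<close>] central s(1) by blast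
  \<comment> \<open>\<open>r\<close> chooses one representative for each label.\<close>
  define r where "r = count_list xs s - Suc k"
  have c: "count_list xs s = Suc k + r" using s(2) by (simp add: r_def)
  have sc: "s \<in> carrier G" and yc: "set ys \<subseteq> carrier G" and zc: "set zs \<subseteq> carrier G"
    using s ys zs commutators_subset by auto
  have rc: "set (replicate r s) \<subseteq> carrier G" using sc by auto
  have "list_product (zs @ replicate r s @ ys) = s [^] Suc k \<otimes> (s [^] r \<otimes> list_product ys)"
    using zs(3) sc yc zc rc by (simp add: list_product_append list_product_replicate del: nat_pow_Suc)
  also have "\<dots> = list_product xs"
    unfolding ys(3) c using sc yc by (simp only: m_assoc nat_pow_closed list_product_closed flip: nat_pow_mult)
  finally show ?thesis using zs ys s c
    by (intro exI[of _ "zs @ replicate r s @ ys"]) auto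
qed

text \<open>
  By repeated shortening, every element of the derived subgroup is a product of at most \<open>n k\<close>
  commutators. Padding with the trivial commutator makes the number of factors constant.
\<close>

theorem finite_derived_subgroup:
  assumes fin: "finite (commutators G)" and card: "card (commutators G) \<le> n" and "k > 0"
    and central: "\<And>t x. t \<in> commutators G \<Longrightarrow> x \<in> carrier G \<Longrightarrow> t [^] k \<otimes> x = x \<otimes> t [^] k"
  shows "finite (generate G (commutators G)) \<and> card (generate G (commutators G)) \<le> n ^ (n * k)"
proof -
  let ?T = "commutators G"
  let ?L = "{xs. set xs \<subseteq> ?T \<and> length xs = card ?T * k}"
  have one: "\<one> \<in> ?T"
    using commutator_eq_one_iff[of \<one> \<one>] unfolding commutators_def by force
  have short: "\<exists>ys. set ys \<subseteq> ?T \<and> length ys \<le> card ?T * k \<and> list_product ys = list_product xs"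
    if "set xs \<subseteq> ?T" for xs
    using that
  proof (induction "length xs" arbitrary: xs rule: less_induct)
    case less
    then show ?case
      using shorten_commutator_product[OF fin \<open>k > 0\<close> central less.prems] by (metis not_le)
  qed
  have "generate G ?T \<subseteq> list_product ` ?L"
  proof
    fix g assume "g \<in> generate G ?T"
    moreover have "inv t \<in> ?T" if "t \<in> ?T" for t
      using that by (auto simp: commutators_def inv_commutator) blast
    ultimately have "g \<in> list_product ` lists ?T"
      using generate_subset_list_products[OF commutators_subset] by blast
    then obtain ys where ys: "set ys \<subseteq> ?T" "length ys \<le> card ?T * k" "list_product ys = g"
      using short by (force simp: lists_eq_set)
    let ?ones = "replicate (card ?T * k - length ys) \<one>"
    have "list_product (ys @ ?ones) = g"
    proof -
      have "set ys \<subseteq> carrier G" "set ?ones \<subseteq> carrier G" using ys(1) commutators_subset by auto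
      then show ?thesis using ys(3) by (auto simp: list_product_append list_product_replicate)
    qed
    then show "g \<in> list_product ` ?L"
      using ys one by (intro image_eqI[of _ _ "ys @ ?ones"]) auto
  qed
  moreover have "finite ?L" by (rule finite_lists_length_eq[OF fin])
  moreover have "card ?L \<le> n ^ (n * k)"
  proof -
    have "card ?T > 0" using fin one card_gt_0_iff by blast
    have "card ?L = card ?T ^ (card ?T * k)" by (rule card_lists_length_eq[OF fin])
    also have "\<dots> \<le> n ^ (card ?T * k)" using card by (rule power_mono) simp
    also have "\<dots> \<le> n ^ (n * k)"
      using card \<open>card ?T > 0\<close> by (intro power_increasing) auto
    finally show ?thesis .
  qed
  ultimately show ?thesis
    by (meson card_image_le card_mono finite_imageI finite_subset le_trans)
qed

end

section \<open>Groups in which a centralizer of finite index centralizes the commutators\<close>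

context group
begin

text \<open>
  The function \<open>cl\<close> labels elements in such a way that powers with equal labels lie in the same
  coset of \<open>C\<close>. With at most \<open>n\<close> labels, two of the powers \<open>x\<^sup>0, \<dots>, x\<^sup>n\<close> share one, so \<open>x\<^sup>i \<in> C\<close>
  for some \<open>0 < i \<le> n\<close>, and \<open>i\<close> divides \<open>n!\<close>.
\<close>

lemma pow_fact_in_subgroup:
  assumes "subgroup C G" "x \<in> carrier G"
    and cl: "finite \<Phi>" "card \<Phi> \<le> n" "\<And>i::nat. cl (x [^] i) \<in> \<Phi>"
    and sep: "\<And>(i::nat) (j::nat). cl (x [^] i) = cl (x [^] j) \<Longrightarrow> inv (x [^] i) \<otimes> x [^] j \<in> C"
  shows "x [^] (fact n :: nat) \<in> C"
proof -
  have "\<not> inj_on (\<lambda>i. cl (x [^] i)) {..n}"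
  proof
    assume "inj_on (\<lambda>i. cl (x [^] i)) {..n}"
    then have "card {..n} \<le> card \<Phi>" using cl by (intro card_inj_on_le) auto
    then show False using cl(2) by simp
  qed
  then obtain a b where ab: "a \<le> n" "b \<le> n" "a \<noteq> b" "cl (x [^] a) = cl (x [^] b)"
    by (auto simp: inj_on_def)
  obtain i j where ij: "i < j" "j \<le> n" "cl (x [^] i) = cl (x [^] j)"
  proof (cases "a < b")
    case True
    then show ?thesis using that[of a b] ab by simp
  next
    case False
    then show ?thesis using that[of b a] ab by simp
  qed
  have "x [^] j = x [^] i \<otimes> x [^] (j - i)"
    using ij(1) assms(2) by (simp add: nat_pow_mult)
  then have "x [^] (j - i) \<in> C"
    using sep[OF ij(3)] assms(2) by (simp add: inv_mult_cancel)
  moreover have "(j - i) dvd fact n" using ij by (intro dvd_fact) auto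
  then obtain q where "fact n = (j - i) * q" by blast
  ultimately show ?thesis
    using subgroup_nat_pow_closed[OF assms(1), of "x [^] (j - i)" q] nat_pow_pow[OF assms(2), of "j - i" q]
    by (simp add: mult.commute)
qed

text \<open>
  The word enters only through the finite, conjugation-invariant set \<open>S\<close>. Writing \<open>x = a c\<close> and
  \<open>y = b d\<close> with coset representatives \<open>a, b\<close> and with \<open>c, d \<in> C\<close> gives
  \<open>[x, y] = [d, a]\<^sup>-\<^sup>1 [a, b] [c, y]\<close>, where \<open>[d, a]\<close> and \<open>[c, y]\<close> belong to \<open>S\<close>; this is the count \<open>N\<close> of
  commutators. The exponent \<open>k\<close> first carries a commutator into \<open>C\<close>, through \<open>(m\<^sup>m)!\<close>, and then
  into the center, through \<open>m!\<close>.
\<close>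

theorem finite_derived_subgroup_of_centralizing_commutators:
  fixes S :: "'a set" and m :: nat
  defines "C \<equiv> centralizer G S"
    and "N \<equiv> m ^ m * m ^ m * m * m" and "k \<equiv> fact (m ^ m) * fact m"
  assumes S: "S \<subseteq> carrier G" "finite S" "card S \<le> m"
    and conj: "\<And>g s. g \<in> carrier G \<Longrightarrow> s \<in> S \<Longrightarrow> g \<otimes> s \<otimes> inv g \<in> S"
    and comm: "\<And>c t. c \<in> C \<Longrightarrow> t \<in> commutators G \<Longrightarrow> c \<otimes> t = t \<otimes> c"
    and vals: "\<And>c g. c \<in> C \<Longrightarrow> g \<in> carrier G \<Longrightarrow> commutator G c g \<in> S"
  shows "finite (generate G (commutators G)) \<and>
         card (generate G (commutators G)) \<le> N ^ (N * k)"
proof -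
  \<comment> \<open>Labelling \<open>x\<close> by its conjugation action on \<open>S\<close> labels the cosets of \<open>C\<close>, without any
    quotient group; there are at most \<open>m\<^sup>m\<close> labels.\<close>
  define cl where "cl x = (\<lambda>s\<in>S. x \<otimes> s \<otimes> inv x)" for x
  define \<Phi> where "\<Phi> = cl ` carrier G"
  have \<Phi>_sub: "\<Phi> \<subseteq> S \<rightarrow>\<^sub>E S" using conj by (auto simp: \<Phi>_def cl_def)
  have finite_maps: "finite (S \<rightarrow>\<^sub>E S)" using S(2) by (intro finite_PiE) auto
  have C1: "\<one> \<in> C" using S by (auto simp: C_def centralizer_def)
  have "S \<noteq> {}" using vals[OF C1 one_closed] by blast
  then have cardS: "0 < card S" using S(2) by (simp add: card_gt_0_iff)
  have fin\<Phi>: "finite \<Phi>" using finite_maps \<Phi>_sub finite_subset by blast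
  have card\<Phi>: "card \<Phi> \<le> m ^ m"
  proof -
    have "card \<Phi> \<le> card (S \<rightarrow>\<^sub>E S)" by (rule card_mono[OF finite_maps \<Phi>_sub])
    also have "\<dots> = card S ^ card S" using S(2) by (simp add: card_funcsetE)
    also have "\<dots> \<le> m ^ card S" using S(3) by (rule power_mono) simp
    also have "\<dots> \<le> m ^ m" using S(3) cardS by (intro power_increasing) auto
    finally show ?thesis .
  qed
  have C_sub: "subgroup C G" unfolding C_def by (rule subgroup_centralizer[OF S(1)])
  have C_carrier: "c \<in> carrier G" if "c \<in> C" for c using that by (simp add: C_def centralizer_def)
  have sep: "inv x \<otimes> y \<in> C" if "x \<in> carrier G" "y \<in> carrier G" "cl x = cl y" for x y
  proof -
    have "inv x \<otimes> y \<otimes> s = s \<otimes> (inv x \<otimes> y)" if s: "s \<in> S" for s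
    proof -
      have sc: "s \<in> carrier G" using s S(1) by blast
      have eq: "x \<otimes> s \<otimes> inv x = y \<otimes> s \<otimes> inv y" using fun_cong[OF \<open>cl x = cl y\<close>, of s] s by (simp add: cl_def)
      have "inv x \<otimes> y \<otimes> s = inv x \<otimes> (y \<otimes> s \<otimes> inv y) \<otimes> y"
        using that sc \<open>x \<in> _\<close> \<open>y \<in> _\<close> by (simp add: free_group_simps)
      also have "\<dots> = s \<otimes> (inv x \<otimes> y)"
        unfolding eq[symmetric] using sc \<open>x \<in> _\<close> \<open>y \<in> _\<close> by (simp add: free_group_simps)
      finally show ?thesis .
    qed
    then show ?thesis using that by (simp add: C_def centralizer_def)
  qed
  have comm': "c \<otimes> commutator G x y = commutator G x y \<otimes> c"
    if "c \<in> C" "x \<in> carrier G" "y \<in> carrier G" for c x y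
    using comm[OF that(1)] that unfolding commutators_def by blast
  \<comment> \<open>The powers of \<open>[c, g]\<close> are the commutators \<open>[c\<^sup>i, g]\<close>, hence all lie in \<open>S\<close>.\<close>
  have pow: "commutator G (c [^] (fact m :: nat)) g = \<one>" if c: "c \<in> C" and g: "g \<in> carrier G" for c g
  proof -
    have cc: "c \<in> carrier G" by (rule C_carrier[OF c])
    have powC: "c [^] i \<in> C" for i :: nat by (rule subgroup_nat_pow_closed[OF C_sub c])
    have hom: "commutator G (c [^] i) g = commutator G c g [^] i" for i :: nat
    proof (induction i)
      case 0
      show ?case using g commutator_eq_one_iff[of \<one> g] by simp
    next
      case (Suc i)
      show ?case
        using commutator_mult_left[of "c [^] i" c g] comm'[OF c, of "c [^] i" g] cc g Suc.IH by simp
    qed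
    have "commutator G c g [^] (fact m :: nat) \<in> {\<one>}"
    proof (rule pow_fact_in_subgroup[where cl = id and \<Phi> = S])
      show "id (commutator G c g [^] i) \<in> S" for i :: nat
        using vals[OF powC g, of i] by (simp add: hom)
      show "subgroup {\<one>} G" by (rule triv_subgroup)
      show "inv (commutator G c g [^] i) \<otimes> commutator G c g [^] j \<in> {\<one>}"
        if "id (commutator G c g [^] i) = id (commutator G c g [^] j)" for i :: nat and j :: nat
        using that cc g by simp
    qed (use cc g S in auto)
    then show "commutator G (c [^] (fact m :: nat)) g = \<one>" unfolding hom by simp
  qed
  have central: "t [^] k \<otimes> x = x \<otimes> t [^] k" if t: "t \<in> commutators G" and x: "x \<in> carrier G" for t x
  proof -
    have tc: "t \<in> carrier G" using t commutators_subset by blast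
    have tC: "t [^] (fact (m ^ m) :: nat) \<in> C"
      by (rule pow_fact_in_subgroup[OF C_sub tc fin\<Phi> card\<Phi>, where cl = cl])
         (use tc sep in \<open>auto simp: \<Phi>_def\<close>)
    have "t [^] k = (t [^] (fact (m ^ m) :: nat)) [^] (fact m :: nat)"
      unfolding k_def using tc by (simp add: nat_pow_pow)
    then show ?thesis using pow[OF tC x] commutator_eq_one_iff[of "t [^] k" x] tc x by simp
  qed
  define r where "r = inv_into (carrier G) cl"
  define F where "F = (\<lambda>(p, q, s, u). inv s \<otimes> commutator G (r p) (r q) \<otimes> u)"
  have r: "r (cl x) \<in> carrier G" "inv (r (cl x)) \<otimes> x \<in> C" if "x \<in> carrier G" for x
  proof -
    have "cl x \<in> cl ` carrier G" using that by blast
    then show "r (cl x) \<in> carrier G" unfolding r_def by (rule inv_into_into)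
    then show "inv (r (cl x)) \<otimes> x \<in> C" using that unfolding r_def by (intro sep) (auto simp: f_inv_into_f)
  qed
  have cover: "commutators G \<subseteq> F ` (\<Phi> \<times> \<Phi> \<times> S \<times> S)"
  proof
    fix t assume "t \<in> commutators G"
    then obtain x y where t: "t = commutator G x y" and xy: "x \<in> carrier G" "y \<in> carrier G"
      by (auto simp: commutators_def)
    let ?a = "r (cl x)" and ?b = "r (cl y)"
    let ?c = "inv ?a \<otimes> x" and ?d = "inv ?b \<otimes> y"
    note a = r[OF xy(1)] and b = r[OF xy(2)]
    have cd: "?c \<in> carrier G" "?d \<in> carrier G" using a b xy by auto
    have "t = commutator G (?a \<otimes> ?c) y" using t xy a by (simp add: inv_mult_cancel)
    also have "\<dots> = commutator G ?a y \<otimes> commutator G ?c y"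
      by (rule commutator_mult_left) (use a xy cd comm' in auto)
    also have "commutator G ?a y = commutator G ?a (?b \<otimes> ?d)" using xy b by (simp add: inv_mult_cancel)
    also have "\<dots> = commutator G ?a ?d \<otimes> commutator G ?a ?b"
      by (rule commutator_mult_right) (use a b cd comm' in auto)
    also have "commutator G ?a ?d = inv (commutator G ?d ?a)"
      using a cd by (simp add: inv_commutator)
    finally have "t = F (cl x, cl y, commutator G ?d ?a, commutator G ?c y)"
      by (simp add: F_def)
    moreover have "(cl x, cl y, commutator G ?d ?a, commutator G ?c y) \<in> \<Phi> \<times> \<Phi> \<times> S \<times> S"
      using vals a b xy by (auto simp: \<Phi>_def)
    ultimately show "t \<in> F ` (\<Phi> \<times> \<Phi> \<times> S \<times> S)" by blast
  qed
  have finP: "finite (\<Phi> \<times> \<Phi> \<times> S \<times> S)" using fin\<Phi> S(2) by simp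
  have "card (commutators G) \<le> card (\<Phi> \<times> \<Phi> \<times> S \<times> S)"
    using surj_card_le[OF finP cover] .
  also have "\<dots> = card \<Phi> * card \<Phi> * card S * card S" by (simp add: card_cartesian_product)
  also have "\<dots> \<le> N" unfolding N_def using card\<Phi> S(3) by (intro mult_le_mono) auto
  finally have "card (commutators G) \<le> N" .
  moreover have "finite (commutators G)" using finP cover finite_surj by blast
  moreover have "k > 0" by (simp add: k_def)
  ultimately show ?thesis using finite_derived_subgroup central by blast
qed

end

section \<open>Word values\<close>

lemma (in group) word_eval_closed [simp]:
  "a \<in> carrier G \<Longrightarrow> b \<in> carrier G \<Longrightarrow> word_eval G w a b \<in> carrier G"
  by (induction w) auto

lemma (in group) word_values_subset: "word_values G w \<subseteq> carrier G"
  by (auto simp: word_values_def)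

lemma word_eval_in_word_values:
  "a \<in> carrier G \<Longrightarrow> b \<in> carrier G \<Longrightarrow> word_eval G w a b \<in> word_values G w"
  unfolding word_values_def by blast

lemma (in group_hom) hom_word_eval:
  "a \<in> carrier G \<Longrightarrow> b \<in> carrier G \<Longrightarrow> h (word_eval G w a b) = word_eval H w (h a) (h b)"
  by (induction w) auto

lemma (in group_hom) hom_commutator:
  "x \<in> carrier G \<Longrightarrow> y \<in> carrier G \<Longrightarrow> h (commutator G x y) = commutator H (h x) (h y)"
  by (simp add: commutator_def)

lemma (in group_hom) image_word_values:
  "h ` word_values G w = {word_eval H w a b | a b. a \<in> h ` carrier G \<and> b \<in> h ` carrier G}"
  (is "_ = ?R")
proof
  show "h ` word_values G w \<subseteq> ?R"
    by (auto simp: word_values_def hom_word_eval) blast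
  show "?R \<subseteq> h ` word_values G w"
  proof
    fix s assume "s \<in> ?R"
    then obtain a b where "s = word_eval H w (h a) (h b)" "a \<in> carrier G" "b \<in> carrier G" by blast
    then have "s = h (word_eval G w a b)" "word_eval G w a b \<in> word_values G w"
      by (auto simp: word_values_def hom_word_eval)
    then show "s \<in> h ` word_values G w" by blast
  qed
qed

lemma (in group) word_values_conj:
  assumes "g \<in> carrier G" "s \<in> word_values G w"
  shows "g \<otimes> s \<otimes> inv g \<in> word_values G w"
proof -
  interpret c: group_hom G G "\<lambda>x. g \<otimes> x \<otimes> inv g"
    by unfold_locales (rule conj_hom[OF assms(1)])
  obtain a b where s: "s = word_eval G w a b" and ab: "a \<in> carrier G" "b \<in> carrier G"
    using assms(2) by (auto simp: word_values_def)
  show ?thesis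
    unfolding s c.hom_word_eval[OF ab] unfolding word_values_def
    by (rule CollectI, intro exI conjI, rule refl) (use ab assms(1) in simp_all)
qed

lemma word_eval_wcomm [simp]:
  "word_eval G (wcomm u v) a b = commutator G (word_eval G u a b) (word_eval G v a b)"
  unfolding wcomm_def commutator_def word_eval.simps ..

lemma (in group) word_eval_wpow [simp]:
  "word_eval G (wpow u n) a b = word_eval G u a b [^] n"
proof (induction n)
  case 0
  show ?case unfolding wpow.simps word_eval.simps nat_pow_0 ..
next
  case (Suc n)
  show ?case unfolding wpow.simps word_eval.simps Suc.IH by (rule nat_pow_Suc[symmetric])
qed

lemma (in group) word_eval_wpow_int [simp]:
  "word_eval G (wpow_int u k) a b = word_eval G u a b [^] k"
  by (cases "k < 0") (simp_all only: wpow_int_def int_pow_def2 if_True if_False word_eval.simps word_eval_wpow)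

section \<open>Olshanskii's word\<close>

text \<open>
  Every block of ten consecutive signs contains five of each kind.
\<close>

lemma sum_olsh_eps: "(\<Sum>i\<leftarrow>[1..<Suc (10 * j)]. olsh_eps i) = 0"
proof (induction j)
  case (Suc j)
  have step: "(\<Sum>i\<leftarrow>[1..<Suc (k + 10)]. olsh_eps i) = (\<Sum>i\<leftarrow>[1..<Suc k]. olsh_eps i)
      + olsh_eps (k + 1) + olsh_eps (k + 2) + olsh_eps (k + 3) + olsh_eps (k + 4) + olsh_eps (k + 5)
      + olsh_eps (k + 6) + olsh_eps (k + 7) + olsh_eps (k + 8) + olsh_eps (k + 9) + olsh_eps (k + 10)" for k
    by (simp add: eval_nat_numeral)
  have "(\<Sum>i\<leftarrow>[1..<Suc (10 * j + 10)]. olsh_eps i) = 0"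
    unfolding step Suc.IH unfolding olsh_eps_def mod_mult_self4 by simp
  then show ?case by (simp add: add.commute)
qed simp

text \<open>
  Without the factors \<open>v\<close>, the word is a power of \<open>[a, b]\<close> with exponent \<open>1 + \<epsilon>\<^sub>1 + \<dots> + \<epsilon>\<^sub>h\<^sub>-\<^sub>1 = 1\<close>.
\<close>

lemma (in group) olsh_word_eval:
  assumes ab: "a \<in> carrier G" "b \<in> carrier G" and v: "word_eval G (olsh_v d) a b = \<one>"
    and h: "h mod 10 = 1"
  shows "word_eval G (olsh_word d n h) a b = commutator G a b"
proof -
  let ?t = "commutator G a b"
  have tc: "?t \<in> carrier G" using ab by simp
  have fold: "word_eval G (foldl Mult (Mult (wcomm VarX VarY) (wpow (olsh_v d) n))
       (map (\<lambda>i. Mult (wpow_int (wcomm VarX VarY) (olsh_eps i)) (wpow (olsh_v d) (n + i))) is)) a b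
      = ?t [^] (1 + (\<Sum>i\<leftarrow>is. olsh_eps i))" for "is"
  proof (induction "is" rule: rev_induct)
    case (snoc i js)
    then show ?case using tc by (simp add: v int_pow_mult[symmetric] add.assoc)
  qed (use v tc in \<open>simp add: int_pow_1\<close>)
  obtain j where "h = Suc (10 * j)" using h by (metis mod_mult_div_eq plus_1_eq_Suc mult.commute)
  then show ?thesis unfolding olsh_word_def fold using sum_olsh_eps[of j] tc by (simp add: int_pow_1)
qed

lemma (in group) olsh_word_values_subset:
  "word_values G (olsh_word d n h) \<subseteq> generate G (commutators G)" (is "_ \<subseteq> ?D")
proof
  fix s assume "s \<in> word_values G (olsh_word d n h)"
  then obtain a b where s: "s = word_eval G (olsh_word d n h) a b" and ab: "a \<in> carrier G" "b \<in> carrier G"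
    by (auto simp: word_values_def)
  have D: "subgroup ?D G" by (rule generate_is_subgroup[OF commutators_subset])
  have comm: "commutator G x y \<in> ?D" if "x \<in> carrier G" "y \<in> carrier G" for x y
    using that by (auto simp: commutators_def intro!: generate.incl)
  have v: "word_eval G (olsh_v d) a b \<in> ?D" using ab by (simp add: olsh_v_def comm)
  have "word_eval G (foldl Mult (Mult (wcomm VarX VarY) (wpow (olsh_v d) n))
       (map (\<lambda>i. Mult (wpow_int (wcomm VarX VarY) (olsh_eps i)) (wpow (olsh_v d) (n + i))) is)) a b
      \<in> ?D" for "is"
  proof (induction "is" rule: rev_induct)
    case Nil
    show ?case using ab v comm by (simp add: subgroup.m_closed[OF D] subgroup_nat_pow_closed[OF D])
  next
    case (snoc i js)
    then show ?case using ab v comm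
      by (simp add: subgroup.m_closed[OF D] subgroup_nat_pow_closed[OF D] subgroup_int_pow_closed[OF D])
  qed
  then show "s \<in> ?D" unfolding s olsh_word_def .
qed

text \<open>
  The subgroup \<open>C\<close> is normal, because \<open>[c, g] \<in> C\<close> for all \<open>c \<in> C\<close>. So the first factor of \<open>v(c, g)\<close>,
  a power of \<open>[c\<^sup>d, g\<^sup>d]\<close>, lies in \<open>C\<close> and commutes with the second, a power of another commutator.
  Hence \<open>v(c, g) = 1\<close>.
\<close>

lemma (in group) olsh_word_value_commutator:
  assumes C: "subgroup C G" and norm: "\<And>c g. c \<in> C \<Longrightarrow> g \<in> carrier G \<Longrightarrow> commutator G c g \<in> C"
    and comm: "\<And>c t. c \<in> C \<Longrightarrow> t \<in> commutators G \<Longrightarrow> c \<otimes> t = t \<otimes> c"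
    and cg: "c \<in> C" "g \<in> carrier G" and h: "h mod 10 = 1"
  shows "commutator G c g \<in> word_values G (olsh_word d n h)"
proof -
  have cc: "c \<in> carrier G" by (rule subgroup.mem_carrier[OF C cg(1)])
  let ?p = "commutator G (c [^] d) (g [^] d)" and ?q = "commutator G (g [^] d) (c [^] (- int d))"
  have p: "?p [^] d \<in> C"
    by (rule subgroup_nat_pow_closed[OF C norm[OF subgroup_nat_pow_closed[OF C cg(1)] nat_pow_closed[OF cg(2)]]])
  have pc: "?p [^] d \<in> carrier G" by (rule subgroup.mem_carrier[OF C p])
  have q: "?q \<in> commutators G"
    by (rule commutator_in_commutators[OF nat_pow_closed[OF cg(2)] int_pow_closed[OF cc]])
  have qc: "?q \<in> carrier G" by (rule subsetD[OF commutators_subset q])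
  have "?p [^] d \<otimes> ?q [^] d = ?q [^] d \<otimes> ?p [^] d"
    by (rule pow_commute[OF qc pc comm[OF p q, symmetric], symmetric])
  then have "commutator G (?p [^] d) (?q [^] d) = \<one>"
    by (rule iffD2[OF commutator_eq_one_iff[OF pc nat_pow_closed[OF qc]]])
  then have "word_eval G (olsh_v d) c g = \<one>"
    by (simp only: olsh_v_def word_eval_wcomm word_eval_wpow word_eval_wpow_int word_eval.simps)
  then have "word_eval G (olsh_word d n h) c g = commutator G c g"
    by (rule olsh_word_eval[OF cc cg(2) _ h])
  then show ?thesis using word_eval_in_word_values[OF cc cg(2), of "olsh_word d n h"] by (simp only:)
qed

section \<open>Finite quotients and residually finite groups\<close>

lemma countable_group_nat_copy:
  assumes "group G" "countable (carrier G)"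
  shows "\<exists>(F :: nat monoid) \<psi>. group F \<and> \<psi> \<in> iso F G"
proof -
  interpret group G by fact
  have inj: "inj_on (to_nat_on (carrier G)) (carrier G)" using assms(2) by (rule inj_on_to_nat_on)
  show ?thesis
    using inj_imp_image_group_is_group[OF inj] iso_set_sym[OF inj_imp_image_group_iso[OF inj]] by blast
qed

text \<open>
  A hypothesis about finite groups on the natural numbers covers finite groups on any type, in
  particular quotient groups, whose elements are sets.
\<close>

lemma finite_group_law_imp_comm_group:
  assumes law: "\<And>F :: nat monoid. group F \<Longrightarrow> finite (carrier F) \<Longrightarrow> is_law F w \<Longrightarrow> comm_group F"
    and "group G" "finite (carrier G)" "is_law G w"
  shows "comm_group G"
proof -
  interpret group G by fact
  obtain F :: "nat monoid" and \<psi> where F: "group F" "\<psi> \<in> iso F G"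
    using countable_group_nat_copy[OF is_group] countable_finite[OF assms(3)] by blast
  interpret h: group_hom F G \<psi>
    using F by (auto simp: group_hom_def group_hom_axioms_def iso_def is_group)
  have inj: "inj_on \<psi> (carrier F)" and surj: "\<psi> ` carrier F = carrier G"
    using F(2) by (auto simp: iso_def bij_betw_def)
  have "word_eval F w a b = \<one>\<^bsub>F\<^esub>" if ab: "a \<in> carrier F" "b \<in> carrier F" for a b
  proof (rule inj_onD[OF inj])
    show "\<psi> (word_eval F w a b) = \<psi> \<one>\<^bsub>F\<^esub>"
      using assms(4) ab by (simp add: h.hom_word_eval is_law_def)
  qed (use ab in auto)
  moreover have "finite (carrier F)" using assms(3) inj surj finite_imageD by metis
  ultimately have "comm_group F" using law F(1) by (simp add: is_law_def)
  then show ?thesis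
    using comm_group.iso_imp_comm_group F(2) is_monoid by (metis is_isoI)
qed

text \<open>
  The quotient of a finite group by its verbal subgroup is finite and satisfies the law, hence is
  abelian by the hypothesis on finite groups.
\<close>

lemma commutators_subset_verbal_subgroup:
  assumes law: "\<And>F :: nat monoid. group F \<Longrightarrow> finite (carrier F) \<Longrightarrow> is_law F w \<Longrightarrow> comm_group F"
    and "group Q" "finite (carrier Q)"
  shows "commutators Q \<subseteq> verbal_subgroup Q w"
proof -
  interpret group Q by fact
  define V where "V = verbal_subgroup Q w"
  interpret V: normal V Q
    unfolding V_def verbal_subgroup_def
    by (rule normal_generateI[OF word_values_subset word_values_conj])
  interpret h: group_hom Q "Q Mod V" "\<lambda>x. V #>\<^bsub>Q\<^esub> x"
    using V.factorgroup_is_group V.r_coset_hom_Mod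
    by (simp add: group_hom_def group_hom_axioms_def is_group)
  have carr: "carrier (Q Mod V) = (\<lambda>x. V #>\<^bsub>Q\<^esub> x) ` carrier Q"
    by (auto simp: FactGroup_def RCOSETS_def)
  have "is_law (Q Mod V) w"
    unfolding is_law_def carr
  proof (intro ballI)
    fix p q assume "p \<in> (\<lambda>x. V #>\<^bsub>Q\<^esub> x) ` carrier Q" "q \<in> (\<lambda>x. V #>\<^bsub>Q\<^esub> x) ` carrier Q"
    then obtain a b where pq: "p = V #>\<^bsub>Q\<^esub> a" "q = V #>\<^bsub>Q\<^esub> b"
      and ab: "a \<in> carrier Q" "b \<in> carrier Q" by blast
    have "word_eval Q w a b \<in> V"
      unfolding V_def verbal_subgroup_def using ab by (auto simp: word_values_def intro!: generate.incl)
    then have "V #>\<^bsub>Q\<^esub> word_eval Q w a b = V" by (simp add: coset_join2 V.subgroup_axioms V.subset[THEN subsetD])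
    then show "word_eval (Q Mod V) w p q = \<one>\<^bsub>Q Mod V\<^esub>"
      unfolding pq using h.hom_word_eval[OF ab, of w] by (simp add: FactGroup_def)
  qed
  moreover have "finite (carrier (Q Mod V))" unfolding carr using assms(3) by simp
  ultimately interpret q: comm_group "Q Mod V"
    using finite_group_law_imp_comm_group[OF law h.H.is_group] by blast
  show ?thesis
  proof
    fix t assume "t \<in> commutators Q"
    then obtain x y where t: "t = commutator Q x y" and xy: "x \<in> carrier Q" "y \<in> carrier Q"
      by (auto simp: commutators_def)
    have "V #>\<^bsub>Q\<^esub> t = commutator (Q Mod V) (V #>\<^bsub>Q\<^esub> x) (V #>\<^bsub>Q\<^esub> y)"
      unfolding t by (rule h.hom_commutator[OF xy])
    also have "\<dots> = \<one>\<^bsub>Q Mod V\<^esub>"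
      by (rule iffD2[OF h.H.commutator_eq_one_iff q.m_comm]) (use xy h.hom_closed in blast)+
    also have "\<dots> = V" by (simp add: FactGroup_def)
    finally show "t \<in> verbal_subgroup Q w"
      using rcos_self[OF _ V.subgroup_axioms, of t] xy by (simp add: t V_def)
  qed
qed

text \<open>
  If \<open>[c, t] \<noteq> 1\<close>, some finite quotient detects it. There \<open>t\<close> agrees with an element \<open>u\<close> of \<open>w(G)\<close>,
  because commutators of a finite group lie in its verbal subgroup and verbal subgroups map onto
  verbal subgroups; but \<open>c\<close> commutes with \<open>u\<close>.
\<close>

lemma centralizer_of_word_values_centralizes_commutators:
  fixes G :: "('a, 'c) monoid_scheme"
  assumes law: "\<And>F :: nat monoid. group F \<Longrightarrow> finite (carrier F) \<Longrightarrow> is_law F w \<Longrightarrow> comm_group F"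
    and "group G" "residually_finite G"
    and c_centralizer: "c \<in> centralizer G (word_values G w)"
    and t: "t \<in> commutators G"
  shows "c \<otimes>\<^bsub>G\<^esub> t = t \<otimes>\<^bsub>G\<^esub> c"
proof (rule ccontr)
  interpret group G by fact
  assume neq: "c \<otimes>\<^bsub>G\<^esub> t \<noteq> t \<otimes>\<^bsub>G\<^esub> c"
  have c: "c \<in> carrier G" "\<And>s. s \<in> word_values G w \<Longrightarrow> c \<otimes>\<^bsub>G\<^esub> s = s \<otimes>\<^bsub>G\<^esub> c"
    using c_centralizer by (auto simp: centralizer_def)
  have tc: "t \<in> carrier G" using t commutators_subset by blast
  then obtain N where N: "N \<lhd> G" "finite (rcosets\<^bsub>G\<^esub> N)" "commutator G c t \<notin> N"
    using assms(3) neq c(1) commutator_eq_one_iff[of c t] unfolding residually_finite_def by blast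
  interpret N: normal N G by (rule N(1))
  let ?Q = "G Mod N"
  define \<pi> where "\<pi> = (\<lambda>x. N #>\<^bsub>G\<^esub> x)"
  interpret h: group_hom G ?Q \<pi>
    using N.factorgroup_is_group N.r_coset_hom_Mod
    by (simp add: \<pi>_def group_hom_def group_hom_axioms_def is_group)
  have carr: "carrier ?Q = \<pi> ` carrier G" by (auto simp: \<pi>_def FactGroup_def RCOSETS_def)
  obtain x y where xy: "t = commutator G x y" "x \<in> carrier G" "y \<in> carrier G"
    using t by (auto simp: commutators_def)
  have "\<pi> t \<in> commutators ?Q"
    unfolding xy(1) h.hom_commutator[OF xy(2,3)]
    by (rule h.H.commutator_in_commutators[OF h.hom_closed[OF xy(2)] h.hom_closed[OF xy(3)]])
  then have "\<pi> t \<in> generate ?Q (word_values ?Q w)"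
    using commutators_subset_verbal_subgroup[OF law h.H.is_group] N(2)
    unfolding verbal_subgroup_def by (auto simp: FactGroup_def)
  also have "word_values ?Q w = \<pi> ` word_values G w"
    unfolding h.image_word_values carr[symmetric] by (simp add: word_values_def)
  also have "generate ?Q (\<pi> ` word_values G w) = \<pi> ` generate G (word_values G w)"
    by (rule h.generate_img[OF word_values_subset])
  finally obtain u where u: "u \<in> generate G (word_values G w)" "\<pi> t = \<pi> u" by blast
  have uc: "u \<in> carrier G" using u(1) generate_in_carrier[OF word_values_subset] by blast
  have "commutator G c u = \<one>\<^bsub>G\<^esub>"
  proof -
    have "word_values G w \<subseteq> centralizer G {c}"
      using c word_values_subset by (auto simp: centralizer_def)
    then have "generate G (word_values G w) \<subseteq> centralizer G {c}"
      using c(1) by (intro generate_subgroup_incl subgroup_centralizer) auto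
    then have "c \<otimes>\<^bsub>G\<^esub> u = u \<otimes>\<^bsub>G\<^esub> c" using u(1) by (auto simp: centralizer_def)
    then show ?thesis using c(1) uc by (simp add: commutator_eq_one_iff)
  qed
  then have "\<pi> (commutator G c t) = \<one>\<^bsub>?Q\<^esub>"
    using h.hom_commutator[OF c(1) tc] h.hom_commutator[OF c(1) uc] u(2) h.hom_one by simp
  then have "commutator G c t \<in> N"
    using rcos_self[OF _ N.subgroup_axioms, of "commutator G c t"] c(1) tc
    by (simp add: \<pi>_def FactGroup_def)
  with N(3) show False by contradiction
qed

definition olsh_bound :: "nat \<Rightarrow> nat" where
  "olsh_bound m = (let N = m ^ m * m ^ m * m * m in N ^ (N * (fact (m ^ m) * fact m)))"

lemma olsh_verbal_order_bound:
  assumes law: "\<And>F :: nat monoid. group F \<Longrightarrow> finite (carrier F) \<Longrightarrow>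
                  is_law F (olsh_word d n h) \<Longrightarrow> comm_group F"
    and h: "h mod 10 = 1"
  shows "verbal_order_bound residually_finite (olsh_word d n h) m (olsh_bound m)"
  unfolding verbal_order_bound_def
proof (intro allI impI)
  fix G :: "'a monoid"
  let ?w = "olsh_word d n h"
  assume "group G" and rf: "residually_finite G" and S: "finite (word_values G ?w)" "card (word_values G ?w) \<le> m"
  interpret group G by fact
  define C where "C = centralizer G (word_values G ?w)"
  have comm: "c \<otimes>\<^bsub>G\<^esub> t = t \<otimes>\<^bsub>G\<^esub> c" if "c \<in> C" "t \<in> commutators G" for c t
    using centralizer_of_word_values_centralizes_commutators[OF law is_group rf] that
    by (simp add: C_def)
  have norm: "g \<otimes>\<^bsub>G\<^esub> c \<otimes>\<^bsub>G\<^esub> inv\<^bsub>G\<^esub> g \<in> C" if "c \<in> C" "g \<in> carrier G" for c g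
    using centralizer_conj[OF word_values_subset word_values_conj] that by (simp add: C_def)
  have C: "subgroup C G" unfolding C_def by (rule subgroup_centralizer[OF word_values_subset])
  have vals: "commutator G c g \<in> word_values G ?w" if cg: "c \<in> C" "g \<in> carrier G" for c g
  proof (rule olsh_word_value_commutator[OF C _ comm cg h])
    fix c g assume cg: "c \<in> C" "g \<in> carrier G"
    have cc: "c \<in> carrier G" by (rule subgroup.mem_carrier[OF C cg(1)])
    have "commutator G c g = inv\<^bsub>G\<^esub> c \<otimes>\<^bsub>G\<^esub> (inv\<^bsub>G\<^esub> g \<otimes>\<^bsub>G\<^esub> c \<otimes>\<^bsub>G\<^esub> inv\<^bsub>G\<^esub> (inv\<^bsub>G\<^esub> g))"
      using cc cg(2) by (simp add: commutator_def m_assoc)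
    then show "commutator G c g \<in> C"
      using subgroup.m_closed[OF C] subgroup.m_inv_closed[OF C] norm[OF cg(1), of "inv\<^bsub>G\<^esub> g"] cg by simp
  qed
  have D: "finite (generate G (commutators G)) \<and> card (generate G (commutators G)) \<le> olsh_bound m"
    unfolding olsh_bound_def Let_def
    by (rule finite_derived_subgroup_of_centralizing_commutators[OF word_values_subset S word_values_conj])
       (use comm vals in \<open>simp_all add: C_def\<close>)
  have "verbal_subgroup G ?w \<subseteq> generate G (commutators G)"
    unfolding verbal_subgroup_def
    by (rule generate_subgroup_incl[OF olsh_word_values_subset generate_is_subgroup[OF commutators_subset]])
  then show "finite (verbal_subgroup G ?w) \<and> card (verbal_subgroup G ?w) \<le> olsh_bound m"
    using D by (meson card_mono finite_subset le_trans)
qed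

section \<open>Independence of the element type\<close>

lemma residually_finite_inj_hom:
  assumes "group L" "group G" "residually_finite G" "\<psi> \<in> hom L G" "inj_on \<psi> (carrier L)"
  shows "residually_finite L"
  unfolding residually_finite_def
proof (intro ballI impI)
  interpret L: group L by fact
  interpret G: group G by fact
  interpret i: group_hom L G \<psi> by unfold_locales fact
  fix g assume g: "g \<in> carrier L" "g \<noteq> \<one>\<^bsub>L\<^esub>"
  have "\<psi> g \<noteq> \<one>\<^bsub>G\<^esub>"
    using g inj_onD[OF assms(5), of g "\<one>\<^bsub>L\<^esub>"] by auto
  then obtain N where N: "N \<lhd> G" "finite (rcosets\<^bsub>G\<^esub> N)" "\<psi> g \<notin> N"
    using assms(3) g(1) unfolding residually_finite_def by auto
  interpret N: normal N G by (rule N(1))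
  let ?h = "(\<lambda>x. N #>\<^bsub>G\<^esub> x) \<circ> \<psi>"
  have "?h \<in> hom L (G Mod N)" using hom_compose[OF assms(4) N.r_coset_hom_Mod] .
  then interpret h: group_hom L "G Mod N" ?h
    using N.factorgroup_is_group by (simp add: group_hom_def group_hom_axioms_def L.is_group)
  let ?K = "kernel L (G Mod N) ?h"
  have "(\<lambda>B. the_elem (?h ` B)) ` carrier (L Mod ?K) \<subseteq> carrier (G Mod N)"
    using h.FactGroup_the_elem_mem by blast
  moreover have "finite (carrier (G Mod N))" using N(2) by (simp add: FactGroup_def)
  ultimately have "finite (carrier (L Mod ?K))"
    using h.FactGroup_inj_on finite_imageD finite_subset by blast
  then have "finite (rcosets\<^bsub>L\<^esub> ?K)" by (simp add: FactGroup_def)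
  moreover have "g \<notin> ?K"
    using G.rcos_self[OF _ N.subgroup_axioms, of "\<psi> g"] N(3) g(1) by (auto simp: kernel_def FactGroup_def)
  ultimately show "\<exists>K. K \<lhd> L \<and> finite (rcosets\<^bsub>L\<^esub> K) \<and> g \<notin> K"
    using h.normal_kernel by blast
qed

lemma (in group) countable_generate:
  assumes "A \<subseteq> carrier G" "countable A"
  shows "countable (generate G A)"
proof -
  let ?T = "A \<union> m_inv G ` A"
  have "generate G A \<subseteq> generate G ?T" by (rule mono_generate) simp
  also have "\<dots> \<subseteq> list_product ` lists ?T"
    by (rule generate_subset_list_products) (use assms(1) in auto)
  finally show ?thesis using assms(2) by (auto intro: countable_subset)
qed

text \<open>
  Choose finitely many pairs of arguments that produce all values of \<open>w\<close>. The subgroup they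
  generate is countable and has the same values of \<open>w\<close>, so it can be copied to the natural
  numbers.
\<close>

lemma countable_group_with_same_verbal_subgroup:
  fixes G :: "('a, 'c) monoid_scheme"
  assumes "group G" "finite (word_values G w)"
  shows "\<exists>(F :: nat monoid) \<psi>. group F \<and> \<psi> \<in> hom F G \<and> inj_on \<psi> (carrier F) \<and>
           \<psi> ` word_values F w = word_values G w \<and> \<psi> ` verbal_subgroup F w = verbal_subgroup G w"
proof -
  interpret group G by fact
  let ?val = "\<lambda>(a, b). word_eval G w a b"
  have "word_values G w = ?val ` (carrier G \<times> carrier G)" by (auto simp: word_values_def)
  then obtain P where P: "P \<subseteq> carrier G \<times> carrier G" "finite P" "word_values G w = ?val ` P"
    using finite_subset_image[OF assms(2)] by (metis subset_refl)
  define L where "L = generate G (fst ` P \<union> snd ` P)"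
  have gen: "fst ` P \<union> snd ` P \<subseteq> carrier G" using P(1) by auto
  have sub: "subgroup L G" unfolding L_def by (rule generate_is_subgroup[OF gen])
  have "countable L" unfolding L_def by (rule countable_generate[OF gen]) (use P(2) in \<open>simp add: countable_finite\<close>)
  then obtain F :: "nat monoid" and \<psi> where F: "group F" "\<psi> \<in> iso F (G\<lparr>carrier := L\<rparr>)"
    using countable_group_nat_copy[OF subgroup_imp_group[OF sub]] by auto
  have img: "\<psi> ` carrier F = L" and inj: "inj_on \<psi> (carrier F)"
    using F(2) by (auto simp: iso_def bij_betw_def)
  have hom: "\<psi> \<in> hom F G"
    using F(2) subgroup.subset[OF sub] by (auto simp: iso_def hom_def)
  interpret h: group_hom F G \<psi> using F(1) hom by (simp add: group_hom_def group_hom_axioms_def is_group)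
  have "\<psi> ` word_values F w = word_values G w"
  proof
    show "\<psi> ` word_values F w \<subseteq> word_values G w"
      unfolding h.image_word_values img using subgroup.subset[OF sub] by (auto simp: word_values_def)
    show "word_values G w \<subseteq> \<psi> ` word_values F w"
    proof
      fix s assume "s \<in> word_values G w"
      then obtain a b where ab: "(a, b) \<in> P" "s = word_eval G w a b" using P(3) by auto
      then have "a \<in> L" "b \<in> L" unfolding L_def by (force intro: generate.incl)+
      then show "s \<in> \<psi> ` word_values F w" unfolding h.image_word_values img using ab(2) by blast
    qed
  qed
  then show ?thesis
    using F(1) hom inj h.generate_img[OF h.G.word_values_subset] unfolding verbal_subgroup_def by metis
qed

theorem verbal_order_bound_transfer:
  assumes bound: "verbal_order_bound (residually_finite :: nat monoid \<Rightarrow> bool) w m f"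
  shows "verbal_order_bound (residually_finite :: 'a monoid \<Rightarrow> bool) w m f"
  unfolding verbal_order_bound_def
proof (intro allI impI)
  fix G :: "'a monoid"
  assume G: "group G" "residually_finite G" "finite (word_values G w)" "card (word_values G w) \<le> m"
  obtain F :: "nat monoid" and \<psi> where F: "group F" "\<psi> \<in> hom F G" "inj_on \<psi> (carrier F)"
      "\<psi> ` word_values F w = word_values G w" "\<psi> ` verbal_subgroup F w = verbal_subgroup G w"
    using countable_group_with_same_verbal_subgroup[OF G(1,3)] by blast
  interpret F: group F by (rule F(1))
  have inj: "inj_on \<psi> (word_values F w)" by (rule inj_on_subset[OF F(3) F.word_values_subset])
  have "finite (word_values F w)" "card (word_values F w) \<le> m"
    using G(3,4) inj F(4) finite_imageD card_image by metis+
  moreover have "residually_finite F" by (rule residually_finite_inj_hom[OF F(1) G(1,2) F(2,3)])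
  ultimately have "finite (verbal_subgroup F w)" "card (verbal_subgroup F w) \<le> f"
    using bound F(1) unfolding verbal_order_bound_def by blast+
  then show "finite (verbal_subgroup G w) \<and> card (verbal_subgroup G w) \<le> f"
    unfolding F(5)[symmetric] using card_image_le[of "verbal_subgroup F w" \<psi>] by simp
qed

theorem theorem3p1:
  fixes d n h :: nat
    and K :: "'b monoid" and H :: "'c monoid"
  assumes "d > 0" and "n > 0" and "h mod 10 = 1" and "h > 50000"
    and "group K" and "is_law K (olsh_word d n h)"
    and "infinite (carrier K)" and "\<not> comm_group K"
    and "\<And>F :: nat monoid. group F \<Longrightarrow> finite (carrier F) \<Longrightarrow> is_law F (olsh_word d n h) \<Longrightarrow> comm_group F"
    and "group H" and "finite (word_values H (olsh_word d n h))"
    and "infinite (verbal_subgroup H (olsh_word d n h))"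
  shows "boundedly_concise_rf TYPE('a) (olsh_word d n h)"
  unfolding boundedly_concise_rf_def
  using olsh_verbal_order_bound[OF assms(9,3)] verbal_order_bound_transfer by blast

end
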